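(* Let $G$ be a non-abelian group. Then the restricted direct power $G^{(\infty)}$ is not $\mathbf{q}_\omega$-compact (in the language $\mathcal{L}_g(G^{(\infty)})$).
   Context: $G^\infty=\prod_{i=1}^\infty G$ is the group of all sequences $(g_1,g_2,\dots)$ with $g_i\in G$ and componentwise operations; $G^{(\infty)}$ is its subgroup of all sequences with only finitely many indices $i$ such that $g_i\neq 1$. $\mathcal{L}_g=\{\cdot,{}^{-1},1\}$ is the language of groups, and for a group $H$, $\mathcal{L}_g(H)$ is $\mathcal{L}_g$ extended by a constant symbol for every element of $H$ (interpreted as that element). An $\mathcal{L}_g(H)$-equation is an equality $p(X)=q(X)$ of two terms of $\mathcal{L}_g(H)$. A system is an arbitrary set of equations in a finite set of variables $X=\{x_1,\dots,x_n\}$; $\mathrm{V}_H(\mathbf{S})\subseteq H^n$ denotes its set of solutions in $H$. A group $H$ is $\mathbf{q}_\omega$-compact if for every infinite system $\mathbf{S}$ of $\mathcal{L}_g(H)$-equations (in finitely many variables $X$) and every $\mathcal{L}_g(H)$-equation $p(X)=q(X)$ with $\mathrm{V}_H(\mathbf{S})\subseteq \mathrm{V}_H(p(X)=q(X))$ there is a finite subsystem $\mathbf{S}'\subseteq\mathbf{S}$ with $\mathrm{V}_H(\mathbf{S}')\subseteq \mathrm{V}_H(p(X)=q(X))$. *)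

theory Defs
  imports "HOL-Algebra.Product_Groups"
begin

text \<open>
  Terms in the language of groups extended by constant symbols of type \<open>'c\<close>.
  The variables of an \<open>n\<close>-variable term are \<open>Var 0, \<dots>, Var (n - 1)\<close>.
\<close>

datatype 'c gterm =
    Var nat
  | Const 'c
  | One
  | Mult "'c gterm" "'c gterm"
  | Inv "'c gterm"

fun gvars :: "'c gterm \<Rightarrow> nat set" where
  "gvars (Var i) = {i}"
| "gvars (Const c) = {}"
| "gvars One = {}"
| "gvars (Mult s t) = gvars s \<union> gvars t"
| "gvars (Inv t) = gvars t"

fun gconsts :: "'c gterm \<Rightarrow> 'c set" where
  "gconsts (Var i) = {}"
| "gconsts (Const c) = {c}"
| "gconsts One = {}"
| "gconsts (Mult s t) = gconsts s \<union> gconsts t"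
| "gconsts (Inv t) = gconsts t"

fun geval :: "('a, 'b) monoid_scheme \<Rightarrow> (nat \<Rightarrow> 'a) \<Rightarrow> 'a gterm \<Rightarrow> 'a" where
  "geval H v (Var i) = v i"
| "geval H v (Const c) = c"
| "geval H v One = \<one>\<^bsub>H\<^esub>"
| "geval H v (Mult s t) = geval H v s \<otimes>\<^bsub>H\<^esub> geval H v t"
| "geval H v (Inv t) = inv\<^bsub>H\<^esub> (geval H v t)"

definition gterms :: "('a, 'b) monoid_scheme \<Rightarrow> nat \<Rightarrow> 'a gterm set" where
  "gterms H n = {t. gvars t \<subseteq> {..<n} \<and> gconsts t \<subseteq> carrier H}"

text \<open>
  An equation \<open>p = q\<close> is the pair \<open>(p, q)\<close>; it is a syntactic object.
\<close>

definition gequations :: "('a, 'b) monoid_scheme \<Rightarrow> nat \<Rightarrow> ('a gterm \<times> 'a gterm) set" where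
  "gequations H n = gterms H n \<times> gterms H n"

definition solutions ::
    "('a, 'b) monoid_scheme \<Rightarrow> nat \<Rightarrow> ('a gterm \<times> 'a gterm) set \<Rightarrow> (nat \<Rightarrow> 'a) set" where
  "solutions H n S =
     {v \<in> {..<n} \<rightarrow>\<^sub>E carrier H. \<forall>(p, q)\<in>S. geval H v p = geval H v q}"

text \<open>
  Only \<open>n \<ge> 1\<close> is considered. Including \<open>n = 0\<close> would not change the notion: without variables,
  a solution set is empty or a singleton, and one false equation already forces it to be empty.
\<close>

definition q_omega_compact :: "('a, 'b) monoid_scheme \<Rightarrow> bool" where
  "q_omega_compact H \<longleftrightarrow>
     (\<forall>n\<ge>1. \<forall>S p q.
        S \<subseteq> gequations H n \<and> infinite S \<and> (p, q) \<in> gequations H n \<and>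
        solutions H n S \<subseteq> solutions H n {(p, q)} \<longrightarrow>
        (\<exists>S'\<subseteq>S. finite S' \<and> solutions H n S' \<subseteq> solutions H n {(p, q)}))"

text \<open>
  \<open>sum_group\<close> is the subgroup of finitely supported families in the full direct product, so over
  the index set \<open>UNIV :: nat set\<close> it is the subgroup of finitely supported sequences.
\<close>

abbreviation restricted_direct_power :: "('a, 'b) monoid_scheme \<Rightarrow> (nat \<Rightarrow> 'a) monoid" where
  "restricted_direct_power G \<equiv> sum_group UNIV (\<lambda>_. G)"

end

theory Submission
  imports Defs
begin

text \<open>
  The failure of compactness comes from finite support. Choose non-commuting \<open>a, b\<close> in \<open>G\<close>, so
  that \<open>a\<close> and its conjugate \<open>c = b a b\<inverse>\<close> differ. For every index \<open>i\<close>, put \<open>a\<close> and \<open>c\<close> at place \<open>i\<close>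
  of otherwise trivial sequences \<open>a\<^sub>i\<close> and \<open>c\<^sub>i\<close>, and consider the equation \<open>x a\<^sub>i = c\<^sub>i x\<close>. Away from
  place \<open>i\<close> it reads \<open>x = x\<close>, while at place \<open>i\<close> it is solved by \<open>b\<close> but not by \<open>1\<close>.
  A solution of all these equations would thus be non-trivial at every place, which is impossible
  for a finitely supported sequence; but finitely many of them are solved by the sequence with
  entry \<open>b\<close> at the finitely many places concerned and \<open>1\<close> elsewhere.

  An unsatisfiable system entails every equation, in particular the false one \<open>a\<^sub>0 = 1\<close>,
  whereas no finite subsystem entails that one.
\<close>

definition single_entry :: "('a, 'b) monoid_scheme \<Rightarrow> nat \<Rightarrow> 'a \<Rightarrow> nat \<Rightarrow> 'a" where
  "single_entry G i g = (\<lambda>j. if j = i then g else \<one>\<^bsub>G\<^esub>)"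

definition conjugation_equation ::
    "('a, 'b) monoid_scheme \<Rightarrow> 'a \<Rightarrow> 'a \<Rightarrow> nat \<Rightarrow> (nat \<Rightarrow> 'a) gterm \<times> (nat \<Rightarrow> 'a) gterm" where
  "conjugation_equation G a c i =
     (Mult (Var 0) (Const (single_entry G i a)), Mult (Const (single_entry G i c)) (Var 0))"

lemma carrier_restricted_direct_power:
  assumes "group G"
  shows "carrier (restricted_direct_power G) =
    {f. (\<forall>i. f i \<in> carrier G) \<and> finite {i. f i \<noteq> \<one>\<^bsub>G\<^esub>}}"
  using assms by (auto simp: carrier_sum_group)

lemma single_entry_in_carrier:
  assumes "group G" "g \<in> carrier G"
  shows "single_entry G i g \<in> carrier (restricted_direct_power G)"
  using assms by (auto simp: carrier_restricted_direct_power single_entry_def group.is_monoid)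

lemma conjugation_equation_in_gequations:
  assumes "group G" "a \<in> carrier G" "c \<in> carrier G"
  shows "conjugation_equation G a c i \<in> gequations (restricted_direct_power G) 1"
  using assms
  by (simp add: conjugation_equation_def gequations_def gterms_def single_entry_in_carrier)

lemma inj_conjugation_equation:
  assumes "a \<noteq> \<one>\<^bsub>G\<^esub>"
  shows "inj (conjugation_equation G a c)"
proof (rule injI)
  fix i j
  assume "conjugation_equation G a c i = conjugation_equation G a c j"
  then have "single_entry G i a i = single_entry G j a i"
    by (simp add: conjugation_equation_def)
  with assms show "i = j"
    by (simp add: single_entry_def split: if_splits)
qed

text \<open>
  Since all constants are trivial away from place \<open>i\<close>, the equation only constrains that place.
\<close>

lemma conjugation_equation_holds_iff:
  assumes "group G" "v 0 \<in> carrier (restricted_direct_power G)"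
  shows "(case conjugation_equation G a c i of (p, q) \<Rightarrow>
            geval (restricted_direct_power G) v p = geval (restricted_direct_power G) v q)
         \<longleftrightarrow> v 0 i \<otimes>\<^bsub>G\<^esub> a = c \<otimes>\<^bsub>G\<^esub> v 0 i"
proof -
  interpret group G by fact
  have "v 0 j \<in> carrier G" for j
    using assms by (simp add: carrier_restricted_direct_power)
  then show ?thesis
    by (auto simp: conjugation_equation_def single_entry_def fun_eq_iff)
qed

text \<open>
  A finitely supported sequence has a trivial entry, and there the equation reads \<open>a = c\<close>.
\<close>

lemma conjugation_equations_unsatisfiable:
  assumes "group G" "a \<in> carrier G" "c \<in> carrier G" "a \<noteq> c"
  shows "solutions (restricted_direct_power G) 1 (range (conjugation_equation G a c)) = {}"
proof -
  interpret group G by fact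
  have False if v: "v \<in> solutions (restricted_direct_power G) 1 (range (conjugation_equation G a c))" for v
  proof -
    have v0: "v 0 \<in> carrier (restricted_direct_power G)"
      using v by (auto simp: solutions_def PiE_iff)
    then have "finite {i. v 0 i \<noteq> \<one>\<^bsub>G\<^esub>}"
      by (simp add: carrier_restricted_direct_power)
    then obtain i where i: "v 0 i = \<one>\<^bsub>G\<^esub>"
      using ex_new_if_finite[OF infinite_UNIV_nat] by blast
    have "v 0 i \<otimes>\<^bsub>G\<^esub> a = c \<otimes>\<^bsub>G\<^esub> v 0 i"
      using v conjugation_equation_holds_iff[OF \<open>group G\<close>, of v, OF v0] by (auto simp: solutions_def)
    with i assms show False by simp
  qed
  then show ?thesis by blast
qed

text \<open>
  Solving each equation at its own place by \<open>b\<close> keeps the support finite as long as only finitely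
  many places are involved; the other places are unconstrained.
\<close>

lemma finitely_many_conjugation_equations_satisfiable:
  assumes "group G" "b \<in> carrier G" "b \<otimes>\<^bsub>G\<^esub> a = c \<otimes>\<^bsub>G\<^esub> b" "finite I"
  shows "solutions (restricted_direct_power G) 1 (conjugation_equation G a c ` I) \<noteq> {}"
proof -
  interpret group G by fact
  let ?x = "\<lambda>i. if i \<in> I then b else \<one>\<^bsub>G\<^esub>"
  let ?v = "\<lambda>k\<in>{..<1::nat}. ?x"
  have "?x \<in> carrier (restricted_direct_power G)"
    using assms by (auto simp: carrier_restricted_direct_power intro: finite_subset[of _ I])
  moreover from this have "case conjugation_equation G a c i of (p, q) \<Rightarrow>
      geval (restricted_direct_power G) ?v p = geval (restricted_direct_power G) ?v q"
    if "i \<in> I" for i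
    using that assms by (subst conjugation_equation_holds_iff) simp_all
  ultimately have "?v \<in> solutions (restricted_direct_power G) 1 (conjugation_equation G a c ` I)"
    by (auto simp: solutions_def)
  then show ?thesis by blast
qed

lemma nonabelian_obtains_conjugates:
  assumes "group G" "\<not> comm_group G"
  obtains a b c where "a \<in> carrier G" "b \<in> carrier G" "c \<in> carrier G"
    "b \<otimes>\<^bsub>G\<^esub> a = c \<otimes>\<^bsub>G\<^esub> b" "a \<noteq> c" "a \<noteq> \<one>\<^bsub>G\<^esub>"
proof -
  interpret group G by fact
  obtain a b where ab: "a \<in> carrier G" "b \<in> carrier G" "b \<otimes>\<^bsub>G\<^esub> a \<noteq> a \<otimes>\<^bsub>G\<^esub> b"
    using assms group_comm_groupI by metis
  show thesis
  proof
    show "b \<otimes>\<^bsub>G\<^esub> a = (b \<otimes>\<^bsub>G\<^esub> a \<otimes>\<^bsub>G\<^esub> inv\<^bsub>G\<^esub> b) \<otimes>\<^bsub>G\<^esub> b"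
      using ab by (simp add: m_assoc)
    then show "a \<noteq> b \<otimes>\<^bsub>G\<^esub> a \<otimes>\<^bsub>G\<^esub> inv\<^bsub>G\<^esub> b"
      using ab by metis
    show "a \<noteq> \<one>\<^bsub>G\<^esub>"
      using ab by auto
  qed (use ab in auto)
qed

theorem theorem3p1:
  fixes G :: "('a, 'b) monoid_scheme"
  assumes "group G"
    and "\<not> comm_group G"
  shows "\<not> q_omega_compact (restricted_direct_power G)"
proof
  let ?H = "restricted_direct_power G"
  assume compact: "q_omega_compact ?H"
  obtain a b c where abc: "a \<in> carrier G" "b \<in> carrier G" "c \<in> carrier G"
    "b \<otimes>\<^bsub>G\<^esub> a = c \<otimes>\<^bsub>G\<^esub> b" "a \<noteq> c" "a \<noteq> \<one>\<^bsub>G\<^esub>"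
    using nonabelian_obtains_conjugates[OF assms] .
  let ?e = "conjugation_equation G a c"
  let ?p = "Const (single_entry G 0 a)"
  have "single_entry G 0 a \<noteq> \<one>\<^bsub>?H\<^esub>"
    using abc(6) by (auto simp: single_entry_def fun_eq_iff)
  then have false_eq: "solutions ?H 1 {(?p, One)} = {}"
    by (simp add: solutions_def)
  have "range ?e \<subseteq> gequations ?H 1"
    using conjugation_equation_in_gequations[OF assms(1) abc(1,3)] by blast
  moreover have "infinite (range ?e)"
    using inj_conjugation_equation[of a G c] abc(6) by (simp add: finite_image_iff)
  moreover have "(?p, One) \<in> gequations ?H 1"
    using single_entry_in_carrier[OF assms(1) abc(1)] by (simp add: gequations_def gterms_def)
  moreover have "solutions ?H 1 (range ?e) \<subseteq> solutions ?H 1 {(?p, One)}"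
    using conjugation_equations_unsatisfiable[OF assms(1) abc(1,3,5)] by simp
  ultimately obtain S' where S': "S' \<subseteq> range ?e" "finite S'"
      "solutions ?H 1 S' \<subseteq> solutions ?H 1 {(?p, One)}"
    using compact unfolding q_omega_compact_def by (meson le_refl)
  from S'(1,2) obtain I where "finite I" "S' = ?e ` I"
    by (meson finite_subset_image)
  then have "solutions ?H 1 S' \<noteq> {}"
    using finitely_many_conjugation_equations_satisfiable[OF assms(1) abc(2,4)] by simp
  with S'(3) false_eq show False by simp
qed

end
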